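(* Let $\theta=(\{X_t\}_{t\in G},\{h_t\}_{t\in G})$ be a partial action of a group $G$ on a compact Hausdorff space $X$ such that for each $t\in G$, $X_t$ is a clopen set. Let $\mathcal{C}(X)$ denote the algebra of continuous complex-valued functions on $X$, with the induced partial action $\alpha$ of $G$. Then the partial skew group ring $\mathcal{C}(X)\rtimes_\alpha G$ is simple if, and only if, $\theta$ is topologically free and minimal.
   Context: The group $G$ is arbitrary and written multiplicatively, but its identity element is denoted by $0$. A (topological) partial action of $G$ on $X$ is a pair $\theta=(\{X_t\}_{t\in G},\{h_t\}_{t\in G})$, where each $X_t$ is an open subset of $X$ and each $h_t:X_{t^{-1}}\to X_t$ is a homeomorphism, such that $X_0=X$, $h_0=\mathrm{id}_X$; $h_t(X_{t^{-1}}\cap X_s)=X_t\cap X_{ts}$ for all $s,t\in G$; and $h_t(h_s(x))=h_{ts}(x)$ for all $x\in X_{s^{-1}}\cap X_{s^{-1}t^{-1}}$. The induced partial action $\alpha=(\{D_t\}_{t\in G},\{\alpha_t\}_{t\in G})$ of $G$ on $\mathcal{C}(X)$ is given by $D_t=\mathcal{C}_0(X_t)$ (which for clopen $X_t$ is $\mathcal{C}(X_t)$, identified with the ideal of functions in $\mathcal{C}(X)$ vanishing outside $X_t$) and $\alpha_t:D_{t^{-1}}\to D_t$, $\alpha_t(f)=f\circ h_{t^{-1}}$. The partial skew group ring $\mathcal{C}(X)\rtimes_\alpha G$ is the (purely algebraic) set of all finite formal sums $\sum_{t\in G}f_t\delta_t$ with $f_t\in D_t$, with componentwise addition and multiplication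 determined by $(f_t\delta_t)(g_s\delta_s)=\alpha_t(\alpha_{t^{-1}}(f_t)g_s)\delta_{ts}$. A ring $R$ is simple if $\{0\}$ and $R$ are its only two-sided ideals (no closure condition on ideals). $\theta$ is topologically free if for all $t\neq0$ the set $F_t=\{x\in X_{t^{-1}}:h_t(x)=x\}$ has empty interior. A subset $U\subseteq X$ is invariant if $h_t(U\cap X_{t^{-1}})\subseteq U$ for all $t\in G$. $\theta$ is minimal if there is no proper open invariant subset of $X$, i.e. the only open invariant subsets of $X$ are $\emptyset$ and $X$. *)

theory Defs
  imports "HOL-Analysis.Analysis" "HOL-Algebra.Ideal"
begin

text \<open>The zero ring counts as simple: it has no two-sided ideals besides \<open>{0}\<close> and itself.\<close>

locale simple_ring = ring R for R (structure) +
  assumes trivial_ideals: "ideal I R \<Longrightarrow> I = {\<zero>} \<or> I = carrier R"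

locale topological_partial_action = group G
  for G :: "('g, 'm) monoid_scheme" (structure)
    and X :: "'a topology"
    and Xt :: "'g \<Rightarrow> 'a set"
    and h :: "'g \<Rightarrow> 'a \<Rightarrow> 'a" +
  assumes openin_Xt: "t \<in> carrier G \<Longrightarrow> openin X (Xt t)"
    and homeomorphism: "t \<in> carrier G \<Longrightarrow>
      homeomorphic_map (subtopology X (Xt (inv t))) (subtopology X (Xt t)) (h t)"
    and Xt_one: "Xt \<one> = topspace X"
    and h_one: "x \<in> topspace X \<Longrightarrow> h \<one> x = x"
    and image_Xt: "\<lbrakk>t \<in> carrier G; s \<in> carrier G\<rbrakk> \<Longrightarrow>
      h t ` (Xt (inv t) \<inter> Xt s) = Xt t \<inter> Xt (t \<otimes> s)"
    and h_mult: "\<lbrakk>t \<in> carrier G; s \<in> carrier G; x \<in> Xt (inv s) \<inter> Xt (inv s \<otimes> inv t)\<rbrakk> \<Longrightarrow>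
      h t (h s x) = h (t \<otimes> s) x"

definition topologically_free ::
  "('g, 'm) monoid_scheme \<Rightarrow> 'a topology \<Rightarrow> ('g \<Rightarrow> 'a set) \<Rightarrow> ('g \<Rightarrow> 'a \<Rightarrow> 'a) \<Rightarrow> bool"
  where "topologically_free G X Xt h \<longleftrightarrow>
    (\<forall>t \<in> carrier G. t \<noteq> \<one>\<^bsub>G\<^esub> \<longrightarrow>
      X interior_of {x \<in> Xt (inv\<^bsub>G\<^esub> t). h t x = x} = {})"

definition invariant_set ::
  "('g, 'm) monoid_scheme \<Rightarrow> ('g \<Rightarrow> 'a set) \<Rightarrow> ('g \<Rightarrow> 'a \<Rightarrow> 'a) \<Rightarrow> 'a set \<Rightarrow> bool"
  where "invariant_set G Xt h U \<longleftrightarrow>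
    (\<forall>t \<in> carrier G. h t ` (U \<inter> Xt (inv\<^bsub>G\<^esub> t)) \<subseteq> U)"

definition minimal_action ::
  "('g, 'm) monoid_scheme \<Rightarrow> 'a topology \<Rightarrow> ('g \<Rightarrow> 'a set) \<Rightarrow> ('g \<Rightarrow> 'a \<Rightarrow> 'a) \<Rightarrow> bool"
  where "minimal_action G X Xt h \<longleftrightarrow>
    (\<forall>U. openin X U \<and> invariant_set G Xt h U \<longrightarrow> U = {} \<or> U = topspace X)"

text \<open>HOL functions are total, so a function on the space \<open>X\<close> is represented by its
  extension by \<open>0\<close> to the whole type.\<close>

definition continuous_function_ring :: "'a topology \<Rightarrow> ('a \<Rightarrow> complex) ring"
  where "continuous_function_ring X =
    \<lparr>carrier = {f. continuous_map X euclidean f \<and> (\<forall>x. x \<notin> topspace X \<longrightarrow> f x = 0)},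
     monoid.mult = (\<lambda>f g x. f x * g x),
     one = (\<lambda>x. if x \<in> topspace X then 1 else 0),
     zero = (\<lambda>x. 0),
     add = (\<lambda>f g x. f x + g x)\<rparr>"

text \<open>\<open>C\<^sub>0(Xt t)\<close>, as the ideal of functions in \<open>C(X)\<close> vanishing outside \<open>Xt t\<close>,
  and the maps \<open>f \<mapsto> f \<circ> h\<^bsub>inv t\<^esub>\<close>, whose values are likewise extended by \<open>0\<close> outside \<open>Xt t\<close>.\<close>

definition induced_ideal :: "'a topology \<Rightarrow> ('g \<Rightarrow> 'a set) \<Rightarrow> 'g \<Rightarrow> ('a \<Rightarrow> complex) set"
  where "induced_ideal X Xt t =
    {f \<in> carrier (continuous_function_ring X). \<forall>x. x \<notin> Xt t \<longrightarrow> f x = 0}"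

definition induced_map ::
  "('g, 'm) monoid_scheme \<Rightarrow> ('g \<Rightarrow> 'a set) \<Rightarrow> ('g \<Rightarrow> 'a \<Rightarrow> 'a)
    \<Rightarrow> 'g \<Rightarrow> ('a \<Rightarrow> complex) \<Rightarrow> 'a \<Rightarrow> complex"
  where "induced_map G Xt h t f = (\<lambda>x. if x \<in> Xt t then f (h (inv\<^bsub>G\<^esub> t) x) else 0)"

text \<open>A finite formal sum \<open>\<Sum>t. a\<^sub>t \<delta>\<^sub>t\<close> is represented by its coefficient function
  \<open>t \<mapsto> a\<^sub>t\<close>, set to zero outside \<open>carrier G\<close>. The product is the biadditive extension of
  \<open>(a\<^sub>t \<delta>\<^sub>t) (b\<^sub>s \<delta>\<^sub>s) = \<alpha>\<^sub>t (\<alpha>\<^bsub>inv t\<^esub> (a\<^sub>t) b\<^sub>s) \<delta>\<^bsub>t s\<^esub>\<close>. The unit \<open>1 \<delta>\<^sub>e\<close>, with \<open>e\<close> the identity of \<open>G\<close>, lies in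
  the carrier because the ideal at \<open>e\<close> is all of \<open>A\<close> in a partial action.\<close>

definition coeff_support ::
  "('g, 'm) monoid_scheme \<Rightarrow> ('b, 'n) ring_scheme \<Rightarrow> ('g \<Rightarrow> 'b) \<Rightarrow> 'g set"
  where "coeff_support G A a = {t \<in> carrier G. a t \<noteq> \<zero>\<^bsub>A\<^esub>}"

definition partial_skew_group_ring ::
  "('g, 'm) monoid_scheme \<Rightarrow> ('b, 'n) ring_scheme \<Rightarrow> ('g \<Rightarrow> 'b set) \<Rightarrow> ('g \<Rightarrow> 'b \<Rightarrow> 'b)
    \<Rightarrow> ('g \<Rightarrow> 'b) ring"
  where "partial_skew_group_ring G A D \<alpha> =
    \<lparr>carrier = {a. (\<forall>t \<in> carrier G. a t \<in> D t) \<and> (\<forall>t. t \<notin> carrier G \<longrightarrow> a t = \<zero>\<^bsub>A\<^esub>)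
        \<and> finite (coeff_support G A a)},
     monoid.mult = (\<lambda>a b r.
        finsum A (\<lambda>(t, s). \<alpha> t (\<alpha> (inv\<^bsub>G\<^esub> t) (a t) \<otimes>\<^bsub>A\<^esub> b s))
          {(t, s). t \<in> coeff_support G A a \<and> s \<in> coeff_support G A b \<and> t \<otimes>\<^bsub>G\<^esub> s = r}),
     one = (\<lambda>t. if t = \<one>\<^bsub>G\<^esub> then \<one>\<^bsub>A\<^esub> else \<zero>\<^bsub>A\<^esub>),
     zero = (\<lambda>t. \<zero>\<^bsub>A\<^esub>),
     add = (\<lambda>a b t. a t \<oplus>\<^bsub>A\<^esub> b t)\<rparr>"

end

theory Submission
  imports Defs
begin

text \<open>
  The product \<open>(a b)\<^sub>r (x) = \<Sum>t. a\<^sub>t (x) b\<^bsub>inv t r\<^esub> (h\<^bsub>inv t\<^esub> x)\<close> of the skew group ring is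
  convolution over the arrows of the partial action (\<open>mult_R_eq_conv\<close>). Written in this way, it is
  associative even when the last factor is an arbitrary family of functions (\<open>conv_assoc\<close>), so the
  same computation shows that the skew group ring is a ring and that it acts on the space of all
  functions on \<open>X\<close>.

  A simple ring forces both dynamical properties because their failure produces ideals. The
  elements with all coefficients vanishing outside a fixed invariant open set form an ideal, which
  is nonzero and proper if the set is nonempty and proper. If \<open>h t\<close> with \<open>t \<noteq> 1\<close> is the identity
  on a nonempty open set and \<open>f\<close> is supported there, then \<open>f \<delta>\<^sub>1 - f \<delta>\<^sub>t\<close> acts as zero on
  the functions on \<open>X\<close>, so that the kernel of this representation is a nonzero proper ideal.

  Conversely, let \<open>I\<close> be a nonzero ideal. An element of \<open>I\<close> of minimal support, translated so
  that its coefficient at the identity is nonzero, commutes with \<open>C(X)\<close>, since its commutators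
  with functions lie in \<open>I\<close> and have smaller support. Topological freeness makes \<open>C(X)\<close>
  its own centralizer, so \<open>I\<close> contains a nonzero function
  (\<open>nonzero_ideal_meets_functions\<close>). The points where some function of \<open>I\<close> does not
  vanish form a nonempty open invariant set, which is \<open>X\<close> by minimality. By compactness
  finitely many functions of \<open>I\<close> have no common zero, and the sum of their squared moduli is a
  unit in \<open>I\<close> (\<open>ideal_without_common_zero_is_everything\<close>).
\<close>

section \<open>The ring of continuous functions\<close>

lemma carrier_continuous_function_ring:
  "f \<in> carrier (continuous_function_ring X) \<longleftrightarrow>
    continuous_map X euclidean f \<and> (\<forall>x. x \<notin> topspace X \<longrightarrow> f x = 0)"
  by (simp add: continuous_function_ring_def)

lemma continuous_function_ring_simps [simp]:
  "f \<otimes>\<^bsub>continuous_function_ring X\<^esub> g = (\<lambda>x. f x * g x)"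
  "f \<oplus>\<^bsub>continuous_function_ring X\<^esub> g = (\<lambda>x. f x + g x)"
  "\<zero>\<^bsub>continuous_function_ring X\<^esub> = (\<lambda>x. 0)"
  "\<one>\<^bsub>continuous_function_ring X\<^esub> = (\<lambda>x. if x \<in> topspace X then 1 else 0)"
  by (simp_all add: continuous_function_ring_def)

lemma continuous_function_ring_add_closed:
  assumes "f \<in> carrier (continuous_function_ring X)" "g \<in> carrier (continuous_function_ring X)"
  shows "(\<lambda>x. f x + g x) \<in> carrier (continuous_function_ring X)"
  using assms by (auto simp: carrier_continuous_function_ring intro: continuous_map_add)

lemma continuous_function_ring_mult_closed:
  assumes "f \<in> carrier (continuous_function_ring X)" "g \<in> carrier (continuous_function_ring X)"
  shows "(\<lambda>x. f x * g x) \<in> carrier (continuous_function_ring X)"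
  using assms by (auto simp: carrier_continuous_function_ring continuous_map_atin tendsto_mult)

lemma continuous_function_ring_zero_closed:
  "(\<lambda>x. 0) \<in> carrier (continuous_function_ring X)"
  by (simp add: carrier_continuous_function_ring)

lemma continuous_function_ring_sum_closed:
  assumes "\<And>i. i \<in> S \<Longrightarrow> F i \<in> carrier (continuous_function_ring X)"
  shows "(\<lambda>x. \<Sum>i\<in>S. F i x) \<in> carrier (continuous_function_ring X)"
  using assms
  by (induction S rule: infinite_finite_induct)
    (simp_all add: continuous_function_ring_zero_closed continuous_function_ring_add_closed)

lemma abelian_monoid_continuous_function_ring: "abelian_monoid (continuous_function_ring X)"
  by (rule abelian_monoidI)
    (simp_all add: continuous_function_ring_zero_closed continuous_function_ring_add_closed
      add_ac)

lemma finsum_continuous_function_ring: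
  assumes "finite S" and "\<And>i. i \<in> S \<Longrightarrow> F i \<in> carrier (continuous_function_ring X)"
  shows "finsum (continuous_function_ring X) F S = (\<lambda>x. \<Sum>i\<in>S. F i x)"
proof -
  interpret abelian_monoid "continuous_function_ring X"
    by (rule abelian_monoid_continuous_function_ring)
  show ?thesis
    using assms
  proof (induction S rule: finite_induct)
    case empty
    then show ?case by simp
  next
    case (insert i S)
    then have "finsum (continuous_function_ring X) F (insert i S) =
        F i \<oplus>\<^bsub>continuous_function_ring X\<^esub> finsum (continuous_function_ring X) F S"
      by (intro finsum_insert) auto
    then show ?case using insert by simp
  qed
qed

lemma continuous_extension_by_zero_from_clopen:
  fixes f :: "'a \<Rightarrow> 'b :: real_normed_vector"
  assumes "closedin X C" "openin X C" and f: "continuous_map (subtopology X C) euclidean f"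
  shows "continuous_map X euclidean (\<lambda>x. if x \<in> C then f x else 0)"
proof -
  have C: "C \<subseteq> topspace X" using assms(2) openin_subset by blast
  have "X frontier_of {x. x \<in> C} = {}"
    using assms(1,2) C by (simp add: frontier_of_eq_empty)
  moreover have "X closure_of {x. x \<in> C} = C"
    using assms(1) by (simp add: closure_of_closedin)
  ultimately show ?thesis
    using f by (intro continuous_map_cases) auto
qed

lemma exists_continuous_bump:
  assumes "compact_space X" "Hausdorff_space X" "openin X U" "x \<in> U"
  obtains f where "f \<in> carrier (continuous_function_ring X)" "f x = 1"
    "\<And>y. y \<notin> U \<Longrightarrow> f y = 0"
proof -
  have "completely_regular_space X"
    using assms by (simp add: compact_Hausdorff_or_regular_imp_normal_space
        normal_imp_completely_regular_space)
  moreover have "closedin X (topspace X - U)" "x \<in> topspace X - (topspace X - U)"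
    using assms openin_subset by fastforce+
  ultimately obtain g :: "'a \<Rightarrow> real" where g: "continuous_map X (top_of_set {0..1}) g"
      "g x = 0" "g ` (topspace X - U) \<subseteq> {1}"
    unfolding completely_regular_space_def by meson
  have contg: "continuous_map X euclidean g"
    using g(1) by (simp add: continuous_map_in_subtopology)
  define f where "f y = (if y \<in> topspace X then complex_of_real (1 - g y) else 0)" for y
  have "continuous_map X euclidean (\<lambda>y. complex_of_real (1 - g y))"
    using contg by (auto simp: continuous_map_atin intro!: tendsto_intros)
  then have "continuous_map X euclidean f"
    by (rule continuous_map_eq) (simp add: f_def)
  moreover have "x \<in> topspace X" using assms(3,4) openin_subset by blast
  ultimately show ?thesis
    using that[of f] g(2,3) by (force simp: carrier_continuous_function_ring f_def)
qed

section \<open>The convolution formula for the product\<close>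

locale clopen_partial_action = topological_partial_action G X Xt h
  for G :: "('g, 'm) monoid_scheme" (structure)
    and X :: "'a topology"
    and Xt :: "'g \<Rightarrow> 'a set"
    and h :: "'g \<Rightarrow> 'a \<Rightarrow> 'a" +
  assumes compact: "compact_space X"
    and Hausdorff: "Hausdorff_space X"
    and closedin_Xt: "t \<in> carrier G \<Longrightarrow> closedin X (Xt t)"
begin

abbreviation A where "A \<equiv> continuous_function_ring X"
abbreviation D where "D \<equiv> induced_ideal X Xt"
abbreviation \<alpha> where "\<alpha> \<equiv> induced_map G Xt h"
abbreviation R where "R \<equiv> partial_skew_group_ring G A D \<alpha>"
abbreviation supp where "supp \<equiv> coeff_support G A"

lemma Xt_subset: "t \<in> carrier G \<Longrightarrow> Xt t \<subseteq> topspace X"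
  using openin_Xt openin_subset by blast

lemma h_maps: "\<lbrakk>t \<in> carrier G; x \<in> Xt (inv t)\<rbrakk> \<Longrightarrow> h t x \<in> Xt t"
  using image_Xt[of t "\<one>"] Xt_one Xt_subset[of t] Xt_subset[of "inv t"]
  by (simp add: Int_absorb2) blast

lemma h_inv_maps: "\<lbrakk>t \<in> carrier G; x \<in> Xt t\<rbrakk> \<Longrightarrow> h (inv t) x \<in> Xt (inv t)"
  using h_maps[of "inv t" x] by simp

lemma h_h_inv: "\<lbrakk>t \<in> carrier G; x \<in> Xt t\<rbrakk> \<Longrightarrow> h t (h (inv t) x) = x"
  using h_mult[of t "inv t" x] Xt_one h_one Xt_subset by auto

lemma h_inv_h: "\<lbrakk>t \<in> carrier G; x \<in> Xt (inv t)\<rbrakk> \<Longrightarrow> h (inv t) (h t x) = x"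
  using h_h_inv[of "inv t" x] by simp

lemma h_inv_mem_iff:
  assumes "t \<in> carrier G" "s \<in> carrier G" "x \<in> Xt t"
  shows "h (inv t) x \<in> Xt s \<longleftrightarrow> x \<in> Xt (t \<otimes> s)"
proof
  assume "h (inv t) x \<in> Xt s"
  then have "h t (h (inv t) x) \<in> h t ` (Xt (inv t) \<inter> Xt s)"
    using h_inv_maps assms by blast
  then show "x \<in> Xt (t \<otimes> s)"
    using image_Xt assms h_h_inv by simp
next
  assume "x \<in> Xt (t \<otimes> s)"
  then obtain y where "y \<in> Xt (inv t) \<inter> Xt s" "x = h t y"
    using image_Xt[of t s] assms by blast
  then show "h (inv t) x \<in> Xt s"
    using h_inv_h assms by simp
qed

lemma h_inv_h_inv:
  assumes "t \<in> carrier G" "s \<in> carrier G" "x \<in> Xt t" "h (inv t) x \<in> Xt s"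
  shows "h (inv s) (h (inv t) x) = h (inv (t \<otimes> s)) x"
  using h_mult[of "inv s" "inv t" x] assms h_inv_mem_iff by (simp add: inv_mult_group)

lemma continuous_h_inv:
  assumes "t \<in> carrier G"
  shows "continuous_map (subtopology X (Xt t)) X (h (inv t))"
  using homeomorphism[of "inv t"] assms
  by (auto dest!: homeomorphic_imp_continuous_map simp: continuous_map_in_subtopology)

lemma induced_map_closed:
  assumes "t \<in> carrier G" "f \<in> carrier A"
  shows "\<alpha> t f \<in> D t"
proof -
  have "continuous_map (subtopology X (Xt t)) euclidean (f \<circ> h (inv t))"
    using assms continuous_h_inv by (intro continuous_map_compose[where X'=X])
      (auto simp: carrier_continuous_function_ring)
  then have "continuous_map X euclidean (\<alpha> t f)"
    using continuous_extension_by_zero_from_clopen[OF closedin_Xt openin_Xt, of t] assms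
    by (simp add: induced_map_def o_def)
  then show ?thesis
    using Xt_subset assms
    by (auto simp: induced_ideal_def carrier_continuous_function_ring induced_map_def)
qed

lemma induced_ideal_subset: "f \<in> D t \<Longrightarrow> f \<in> carrier A"
  by (simp add: induced_ideal_def)

lemma induced_ideal_one: "D \<one> = carrier A"
  by (auto simp: induced_ideal_def carrier_continuous_function_ring Xt_one)

lemma carrier_R:
  "a \<in> carrier R \<longleftrightarrow> (\<forall>t \<in> carrier G. a t \<in> D t) \<and> (\<forall>t. t \<notin> carrier G \<longrightarrow> a t = (\<lambda>x. 0))
    \<and> finite (supp a)"
  by (simp add: partial_skew_group_ring_def)

lemma R_simps [simp]:
  "a \<oplus>\<^bsub>R\<^esub> b = (\<lambda>t x. a t x + b t x)"
  "\<zero>\<^bsub>R\<^esub> = (\<lambda>t x. 0)"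
  by (simp_all add: partial_skew_group_ring_def)

lemma supp_iff: "t \<in> supp a \<longleftrightarrow> t \<in> carrier G \<and> (\<exists>x. a t x \<noteq> 0)"
  by (auto simp: coeff_support_def fun_eq_iff)

lemma R_coeff_nonzero:
  assumes "a \<in> carrier R" "a t x \<noteq> 0"
  shows "t \<in> carrier G" "x \<in> Xt t"
  using assms by (auto simp: carrier_R induced_ideal_def)

lemma R_coeff_closed: "a \<in> carrier R \<Longrightarrow> a t \<in> carrier A"
  by (cases "t \<in> carrier G")
    (auto simp: carrier_R induced_ideal_subset continuous_function_ring_zero_closed)

lemma finite_supp: "a \<in> carrier R \<Longrightarrow> finite (supp a)"
  by (simp add: carrier_R)

lemma R_eqI:
  assumes "a \<in> carrier R" "b \<in> carrier R" "\<And>t x. t \<in> carrier G \<Longrightarrow> a t x = b t x"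
  shows "a = b"
proof (intro ext)
  fix t x
  show "a t x = b t x"
    using assms R_coeff_nonzero(1) by (cases "t \<in> carrier G") metis+
qed

text \<open>This is the product of the convolution algebra of the transformation groupoid, whose arrows
  are the pairs of a group element \<open>t\<close> and a point of \<open>Xt t\<close>. The second factor need not
  be continuous or of finite support: associativity then also yields modules over
  the ring made of arbitrary functions.\<close>

definition conv :: "('g \<Rightarrow> 'a \<Rightarrow> complex) \<Rightarrow> ('g \<Rightarrow> 'a \<Rightarrow> complex) \<Rightarrow> 'g \<Rightarrow> 'a \<Rightarrow> complex"
  where "conv a c r x = (\<Sum>t\<in>supp a. a t x * c (inv t \<otimes> r) (h (inv t) x))"

lemma conv_superset:
  assumes "finite S" "supp a \<subseteq> S" "S \<subseteq> carrier G"
  shows "conv a c r x = (\<Sum>t\<in>S. a t x * c (inv t \<otimes> r) (h (inv t) x))"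
  unfolding conv_def using assms
  by (intro sum.mono_neutral_left) (auto simp: supp_iff)

lemma supp_subset: "supp a \<subseteq> carrier G"
  by (auto simp: supp_iff)

text \<open>On the support of \<open>a t\<close> the two applications of the induced maps in
  \<open>\<alpha>\<^sub>t (\<alpha>\<^bsub>inv t\<^esub> (a\<^sub>t) b\<^sub>s)\<close> cancel on the first factor, because \<open>h t\<close> and \<open>h (inv t)\<close> are
  mutually inverse; what remains is \<open>a\<^sub>t (b\<^sub>s \<circ> h\<^bsub>inv t\<^esub>)\<close>.\<close>

lemma mult_R_eq_conv:
  assumes a: "a \<in> carrier R" and b: "b \<in> carrier R" and r: "r \<in> carrier G"
  shows "(a \<otimes>\<^bsub>R\<^esub> b) r = conv a b r"
proof
  fix x
  let ?Q = "{(t, s). t \<in> supp a \<and> s \<in> supp b \<and> t \<otimes> s = r}"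
  let ?T = "{t \<in> supp a. inv t \<otimes> r \<in> supp b}"
  let ?F = "\<lambda>(t, s). \<alpha> t (\<alpha> (inv t) (a t) \<otimes>\<^bsub>A\<^esub> b s)"
  have fin: "finite ?Q"
    by (rule finite_subset[of _ "supp a \<times> supp b"]) (use a b finite_supp in auto)
  have closed: "?F p \<in> carrier A" if "p \<in> ?Q" for p
  proof -
    obtain t s where p: "p = (t, s)" by force
    then have "t \<in> carrier G" using that by (simp add: supp_iff)
    then have "\<alpha> (inv t) (a t) \<in> carrier A"
      using induced_map_closed R_coeff_closed[OF a] induced_ideal_subset by blast
    then show ?thesis
      using \<open>t \<in> carrier G\<close> R_coeff_closed[OF b] p
      by (auto intro!: induced_ideal_subset[OF induced_map_closed]
          continuous_function_ring_mult_closed)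
  qed
  have F_apply: "?F (t, s) x = a t x * b s (h (inv t) x)" if "t \<in> carrier G" for t s
  proof (cases "x \<in> Xt t")
    case True
    then show ?thesis
      using that h_inv_maps h_h_inv by (simp add: induced_map_def)
  next
    case False
    then show ?thesis
      using R_coeff_nonzero(2)[OF a] by (auto simp: induced_map_def)
  qed
  have Q: "?Q = (\<lambda>t. (t, inv t \<otimes> r)) ` ?T"
  proof (intro equalityI subsetI)
    fix p assume "p \<in> ?Q"
    then obtain t s where p: "p = (t, s)" "t \<in> supp a" "s \<in> supp b" "t \<otimes> s = r"
      by blast
    then have "inv t \<otimes> r = s"
      using supp_subset by (auto simp: m_assoc[symmetric] supp_iff)
    then show "p \<in> (\<lambda>t. (t, inv t \<otimes> r)) ` ?T" using p by auto
  next
    fix p assume "p \<in> (\<lambda>t. (t, inv t \<otimes> r)) ` ?T"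
    then show "p \<in> ?Q"
      using r by (auto simp: supp_iff m_assoc[symmetric])
  qed
  have "(a \<otimes>\<^bsub>R\<^esub> b) r x = finsum A ?F ?Q x"
    by (simp add: partial_skew_group_ring_def)
  also have "\<dots> = (\<Sum>p\<in>?Q. ?F p x)"
    using finsum_continuous_function_ring[OF fin closed] by simp
  also have "\<dots> = (\<Sum>t\<in>?T. ?F (t, inv t \<otimes> r) x)"
    unfolding Q by (subst sum.reindex) (auto simp: inj_on_def)
  also have "\<dots> = (\<Sum>t\<in>?T. a t x * b (inv t \<otimes> r) (h (inv t) x))"
    by (intro sum.cong refl F_apply) (simp add: supp_iff)
  also have "\<dots> = conv a b r x"
    unfolding conv_def using a r finite_supp
    by (intro sum.mono_neutral_left) (auto simp: supp_iff)
  finally show "(a \<otimes>\<^bsub>R\<^esub> b) r x = conv a b r x" .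
qed

lemma mult_R_outside:
  assumes "r \<notin> carrier G"
  shows "(a \<otimes>\<^bsub>R\<^esub> b) r = (\<lambda>x. 0)"
proof -
  interpret abelian_monoid A by (rule abelian_monoid_continuous_function_ring)
  have "{(t, s). t \<in> supp a \<and> s \<in> supp b \<and> t \<otimes> s = r} = {}"
    using assms by (auto simp: supp_iff)
  then have "(a \<otimes>\<^bsub>R\<^esub> b) r = \<zero>\<^bsub>A\<^esub>"
    by (simp only: partial_skew_group_ring_def monoid.simps finsum_empty)
  then show ?thesis by simp
qed

lemma conv_nonzero:
  assumes "conv a c r x \<noteq> 0"
  obtains t where "t \<in> supp a" "a t x \<noteq> 0" "c (inv t \<otimes> r) (h (inv t) x) \<noteq> 0"
proof -
  from assms obtain t where "t \<in> supp a" "a t x * c (inv t \<otimes> r) (h (inv t) x) \<noteq> 0"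
    unfolding conv_def by (rule sum.not_neutral_contains_not_neutral)
  then show thesis using that[of t] by simp
qed

lemma supp_mult_subset:
  assumes "a \<in> carrier R" "b \<in> carrier R"
  shows "supp (a \<otimes>\<^bsub>R\<^esub> b) \<subseteq> (\<lambda>(t, s). t \<otimes> s) ` (supp a \<times> supp b)"
proof
  fix r assume "r \<in> supp (a \<otimes>\<^bsub>R\<^esub> b)"
  then obtain x where r: "r \<in> carrier G" "conv a b r x \<noteq> 0"
    using mult_R_eq_conv[OF assms] by (auto simp: supp_iff)
  then obtain t where "t \<in> supp a" "b (inv t \<otimes> r) (h (inv t) x) \<noteq> 0"
    using conv_nonzero by blast
  moreover from this have "r = t \<otimes> (inv t \<otimes> r)" "inv t \<otimes> r \<in> carrier G"
    using r(1) by (auto simp: supp_iff m_assoc[symmetric])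
  ultimately show "r \<in> (\<lambda>(t, s). t \<otimes> s) ` (supp a \<times> supp b)"
    by (intro image_eqI[of _ _ "(t, inv t \<otimes> r)"]) (auto simp: supp_iff)
qed

lemma finite_supp_mult:
  assumes "a \<in> carrier R" "b \<in> carrier R"
  shows "finite ((\<lambda>(t, s). t \<otimes> s) ` (supp a \<times> supp b))"
  using assms by (intro finite_imageI finite_cartesian_product finite_supp)

lemma mult_R_closed:
  assumes a: "a \<in> carrier R" and b: "b \<in> carrier R"
  shows "a \<otimes>\<^bsub>R\<^esub> b \<in> carrier R"
proof -
  have "conv a b r \<in> D r" if r: "r \<in> carrier G" for r
  proof -
    have "(\<lambda>x. a t x * b (inv t \<otimes> r) (h (inv t) x)) \<in> carrier A" if "t \<in> supp a" for t
    proof -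
      have "\<alpha> t (b (inv t \<otimes> r)) \<in> carrier A"
        using that induced_ideal_subset[OF induced_map_closed[OF _ R_coeff_closed[OF b]]]
        by (simp add: supp_iff)
      then have "(\<lambda>x. a t x * \<alpha> t (b (inv t \<otimes> r)) x) \<in> carrier A"
        by (rule continuous_function_ring_mult_closed[OF R_coeff_closed[OF a]])
      moreover have "(\<lambda>x. a t x * \<alpha> t (b (inv t \<otimes> r)) x) =
          (\<lambda>x. a t x * b (inv t \<otimes> r) (h (inv t) x))"
        using R_coeff_nonzero(2)[OF a] by (force simp: induced_map_def fun_eq_iff)
      ultimately show ?thesis by simp
    qed
    then have "(\<lambda>x. conv a b r x) \<in> carrier A"
      unfolding conv_def by (rule continuous_function_ring_sum_closed)
    moreover have "x \<in> Xt r" if nz: "conv a b r x \<noteq> 0" for x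
    proof -
      obtain t where "a t x \<noteq> 0" and bt: "b (inv t \<otimes> r) (h (inv t) x) \<noteq> 0"
        using conv_nonzero[OF nz] .
      then have t: "t \<in> carrier G" "x \<in> Xt t" using R_coeff_nonzero[OF a] by auto
      have "h (inv t) x \<in> Xt (inv t \<otimes> r)"
        using R_coeff_nonzero(2)[OF b bt] .
      then show ?thesis
        using h_inv_mem_iff[of t "inv t \<otimes> r" x] t r by (simp flip: m_assoc)
    qed
    ultimately show ?thesis by (auto simp: induced_ideal_def)
  qed
  then show ?thesis
    using mult_R_eq_conv[OF a b] mult_R_outside
      finite_subset[OF supp_mult_subset[OF a b] finite_supp_mult[OF a b]]
    by (simp add: carrier_R)
qed

text \<open>Both sides are sums over \<open>t\<close> and \<open>s\<close>, with \<open>u = t s\<close> on the left. The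
  identity \<open>h\<^bsub>inv s\<^esub> (h\<^bsub>inv t\<^esub> x) = h\<^bsub>inv u\<^esub> x\<close> is available exactly at the points where the
  coefficients \<open>a\<^sub>t (x)\<close> and \<open>b\<^sub>s (h\<^bsub>inv t\<^esub> x)\<close> are both nonzero.\<close>

lemma conv_assoc:
  assumes a: "a \<in> carrier R" and b: "b \<in> carrier R" and r: "r \<in> carrier G"
  shows "conv (a \<otimes>\<^bsub>R\<^esub> b) c r x = conv a (conv b c) r x"
proof -
  let ?P = "(\<lambda>(t, s). t \<otimes> s) ` (supp a \<times> supp b)"
  have P: "?P \<subseteq> carrier G" by (auto simp: supp_iff)
  have inner: "a t x * (\<Sum>u\<in>?P. b (inv t \<otimes> u) (h (inv t) x) * c (inv u \<otimes> r) (h (inv u) x)) =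
      a t x * conv b c (inv t \<otimes> r) (h (inv t) x)" if t: "t \<in> supp a" for t
  proof (cases "a t x = 0")
    case False
    then have tx: "t \<in> carrier G" "x \<in> Xt t" using R_coeff_nonzero[OF a] by auto
    have "(\<Sum>u\<in>?P. b (inv t \<otimes> u) (h (inv t) x) * c (inv u \<otimes> r) (h (inv u) x)) =
        (\<Sum>u\<in>(\<lambda>s. t \<otimes> s) ` supp b. b (inv t \<otimes> u) (h (inv t) x) * c (inv u \<otimes> r) (h (inv u) x))"
    proof (rule sum.mono_neutral_right)
      show "finite ?P" using finite_supp_mult[OF a b] .
      show "(\<lambda>s. t \<otimes> s) ` supp b \<subseteq> ?P" using t by auto
      show "\<forall>u\<in>?P - (\<lambda>s. t \<otimes> s) ` supp b.
          b (inv t \<otimes> u) (h (inv t) x) * c (inv u \<otimes> r) (h (inv u) x) = 0"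
      proof
        fix u assume u: "u \<in> ?P - (\<lambda>s. t \<otimes> s) ` supp b"
        then have "u \<in> carrier G" using P by auto
        then have "u = t \<otimes> (inv t \<otimes> u)" using tx by (simp add: m_assoc[symmetric])
        then have "inv t \<otimes> u \<notin> supp b" using u by blast
        then show "b (inv t \<otimes> u) (h (inv t) x) * c (inv u \<otimes> r) (h (inv u) x) = 0"
          using tx \<open>u \<in> carrier G\<close> by (auto simp: supp_iff)
      qed
    qed
    also have "\<dots> = (\<Sum>s\<in>supp b. b (inv t \<otimes> (t \<otimes> s)) (h (inv t) x) *
        c (inv (t \<otimes> s) \<otimes> r) (h (inv (t \<otimes> s)) x))"
      using tx by (subst sum.reindex) (auto simp: inj_on_def supp_iff)
    also have "\<dots> = conv b c (inv t \<otimes> r) (h (inv t) x)"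
      unfolding conv_def
    proof (intro sum.cong refl)
      fix s assume "s \<in> supp b"
      then have s: "s \<in> carrier G" by (simp add: supp_iff)
      have "inv t \<otimes> (t \<otimes> s) = s" using s tx by (simp add: m_assoc[symmetric])
      moreover have "inv (t \<otimes> s) \<otimes> r = inv s \<otimes> (inv t \<otimes> r)"
        using s tx r by (simp add: inv_mult_group m_assoc)
      moreover have "h (inv (t \<otimes> s)) x = h (inv s) (h (inv t) x)"
        if "b s (h (inv t) x) \<noteq> 0"
        using h_inv_h_inv[OF tx(1) s tx(2)] R_coeff_nonzero[OF b that] by simp
      ultimately show "b (inv t \<otimes> (t \<otimes> s)) (h (inv t) x) *
          c (inv (t \<otimes> s) \<otimes> r) (h (inv (t \<otimes> s)) x) =
          b s (h (inv t) x) * c (inv s \<otimes> (inv t \<otimes> r)) (h (inv s) (h (inv t) x))"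
        by (cases "b s (h (inv t) x) = 0") simp_all
    qed
    finally show ?thesis by simp
  qed simp
  have "conv (a \<otimes>\<^bsub>R\<^esub> b) c r x =
      (\<Sum>u\<in>?P. (a \<otimes>\<^bsub>R\<^esub> b) u x * c (inv u \<otimes> r) (h (inv u) x))"
    by (rule conv_superset[OF finite_supp_mult[OF a b] supp_mult_subset[OF a b] P])
  also have "\<dots> = (\<Sum>u\<in>?P. conv a b u x * c (inv u \<otimes> r) (h (inv u) x))"
    by (intro sum.cong refl arg_cong2[where f="(*)"] fun_cong[OF mult_R_eq_conv[OF a b]])
      (use P in blast)
  also have "\<dots> = (\<Sum>u\<in>?P. \<Sum>t\<in>supp a.
      a t x * (b (inv t \<otimes> u) (h (inv t) x) * c (inv u \<otimes> r) (h (inv u) x)))"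
    by (simp only: conv_def[of a b] sum_distrib_right mult.assoc)
  also have "\<dots> = (\<Sum>t\<in>supp a. \<Sum>u\<in>?P.
      a t x * (b (inv t \<otimes> u) (h (inv t) x) * c (inv u \<otimes> r) (h (inv u) x)))"
    by (rule sum.swap)
  also have "\<dots> = (\<Sum>t\<in>supp a. a t x *
      (\<Sum>u\<in>?P. b (inv t \<otimes> u) (h (inv t) x) * c (inv u \<otimes> r) (h (inv u) x)))"
    by (simp only: sum_distrib_left)
  also have "\<dots> = conv a (conv b c) r x"
    unfolding conv_def[of a "conv b c"] using inner by (intro sum.cong refl)
  finally show ?thesis .
qed

lemma conv_cong_right:
  assumes "r \<in> carrier G" "\<And>s y. s \<in> carrier G \<Longrightarrow> c s y = d s y"
  shows "conv a c r x = conv a d r x"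
  unfolding conv_def using assms by (intro sum.cong refl) (auto simp: supp_iff)

lemma supp_add_subset: "supp (\<lambda>t x. a t x + b t x) \<subseteq> supp a \<union> supp b"
  by (auto simp: supp_iff)

lemma conv_add_left:
  assumes "a \<in> carrier R" "b \<in> carrier R"
  shows "conv (\<lambda>t x. a t x + b t x) c r x = conv a c r x + conv b c r x"
proof -
  let ?S = "supp a \<union> supp b"
  have S: "finite ?S" "?S \<subseteq> carrier G"
    using assms finite_supp supp_subset by auto
  show ?thesis
    using conv_superset[OF S(1) supp_add_subset S(2), of c r x]
      conv_superset[of ?S a c r x] conv_superset[of ?S b c r x] S
    by (simp add: distrib_right sum.distrib)
qed

lemma conv_add_right:
  "conv a (\<lambda>t x. b t x + c t x) r x = conv a b r x + conv a c r x"
  by (simp add: conv_def distrib_left sum.distrib)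

definition single :: "'g \<Rightarrow> ('a \<Rightarrow> complex) \<Rightarrow> 'g \<Rightarrow> 'a \<Rightarrow> complex"
  where "single t f = (\<lambda>s x. if s = t then f x else 0)"

lemma supp_single: "supp (single t f) \<subseteq> {t}"
  by (auto simp: supp_iff single_def split: if_splits)

lemma single_closed:
  assumes "t \<in> carrier G" "f \<in> D t"
  shows "single t f \<in> carrier R"
proof -
  have "(\<lambda>x. 0) \<in> D s" for s
    by (simp add: induced_ideal_def continuous_function_ring_zero_closed)
  then have "single t f s \<in> D s" for s
    using assms by (cases "s = t") (simp_all add: single_def)
  moreover have "finite (supp (single t f))"
    using supp_single finite_subset by blast
  ultimately show ?thesis
    using assms by (auto simp: carrier_R single_def)
qed

lemma conv_single_left:
  assumes "t \<in> carrier G"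
  shows "conv (single t f) c r x = f x * c (inv t \<otimes> r) (h (inv t) x)"
  using assms conv_superset[OF _ supp_single, of t f c r x] by (simp add: single_def)

lemma conv_single_right:
  assumes a: "a \<in> carrier R" and G: "s \<in> carrier G" "r \<in> carrier G"
  shows "conv a (single s f) r x = a (r \<otimes> inv s) x * f (h (inv (r \<otimes> inv s)) x)"
proof -
  let ?u = "r \<otimes> inv s"
  let ?S = "insert ?u (supp a)"
  have S: "finite ?S" "?S \<subseteq> carrier G"
    using a G finite_supp supp_subset by auto
  have eq: "inv t \<otimes> r = s \<longleftrightarrow> t = ?u" if "t \<in> carrier G" for t
    using that G by (metis inv_closed inv_solve_left inv_solve_right)
  have "conv a (single s f) r x =
      (\<Sum>t\<in>?S. a t x * single s f (inv t \<otimes> r) (h (inv t) x))"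
    by (rule conv_superset) (use S in auto)
  also have "\<dots> = (\<Sum>t\<in>?S. if t = ?u then a t x * f (h (inv t) x) else 0)"
    using S(2) eq by (intro sum.cong refl) (auto simp: single_def)
  also have "\<dots> = a ?u x * f (h (inv ?u) x)"
    using S(1) by (subst sum.delta) simp_all
  finally show ?thesis .
qed

abbreviation unit_on :: "'g \<Rightarrow> 'a \<Rightarrow> complex"
  where "unit_on t \<equiv> (\<lambda>x. if x \<in> Xt t then 1 else 0)"

text \<open>That \<open>Xt t\<close> is clopen makes its indicator function continuous; it is the unit of the
  ideal at \<open>t\<close>.\<close>

lemma unit_on_closed:
  assumes "t \<in> carrier G"
  shows "unit_on t \<in> D t"
  using continuous_extension_by_zero_from_clopen[OF closedin_Xt openin_Xt, of t "\<lambda>_. 1::complex"]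
    assms Xt_subset
  by (auto simp: induced_ideal_def carrier_continuous_function_ring)

lemma one_R: "\<one>\<^bsub>R\<^esub> = single \<one> (unit_on \<one>)"
  by (auto simp: partial_skew_group_ring_def single_def Xt_one fun_eq_iff)

lemma one_R_closed: "\<one>\<^bsub>R\<^esub> \<in> carrier R"
  unfolding one_R by (simp add: single_closed unit_on_closed)

lemma add_R_closed:
  assumes "a \<in> carrier R" "b \<in> carrier R"
  shows "a \<oplus>\<^bsub>R\<^esub> b \<in> carrier R"
proof -
  have "finite (supp (\<lambda>t x. a t x + b t x))"
    using finite_subset[OF supp_add_subset] assms finite_supp by blast
  then show ?thesis
    using assms by (auto simp: carrier_R induced_ideal_def continuous_function_ring_add_closed)
qed

lemma zero_R_closed: "\<zero>\<^bsub>R\<^esub> \<in> carrier R"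
  by (auto simp: carrier_R induced_ideal_def continuous_function_ring_zero_closed
      coeff_support_def)

lemma uminus_R_closed:
  assumes "a \<in> carrier R"
  shows "(\<lambda>t x. - a t x) \<in> carrier R"
proof -
  have "supp (\<lambda>t x. - a t x) = supp a" by (auto simp: supp_iff)
  then show ?thesis
    using assms by (auto simp: carrier_R induced_ideal_def carrier_continuous_function_ring
        continuous_map_minus)
qed

lemma ring_R: "ring R"
proof (rule ringI)
  show "abelian_group R"
  proof (rule abelian_groupI)
    fix a assume "a \<in> carrier R"
    then show "\<exists>b\<in>carrier R. b \<oplus>\<^bsub>R\<^esub> a = \<zero>\<^bsub>R\<^esub>"
      by (intro bexI[OF _ uminus_R_closed]) auto
  qed (use add_R_closed zero_R_closed in \<open>auto simp: add_ac\<close>)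
  show "monoid R"
  proof (rule monoidI)
    fix a b c assume abc: "a \<in> carrier R" "b \<in> carrier R" "c \<in> carrier R"
    show "(a \<otimes>\<^bsub>R\<^esub> b) \<otimes>\<^bsub>R\<^esub> c = a \<otimes>\<^bsub>R\<^esub> (b \<otimes>\<^bsub>R\<^esub> c)"
    proof (rule R_eqI)
      fix r x assume r: "r \<in> carrier G"
      have "conv a (conv b c) r x = conv a (b \<otimes>\<^bsub>R\<^esub> c) r x"
        using abc r by (intro conv_cong_right) (simp_all add: mult_R_eq_conv)
      then show "((a \<otimes>\<^bsub>R\<^esub> b) \<otimes>\<^bsub>R\<^esub> c) r x = (a \<otimes>\<^bsub>R\<^esub> (b \<otimes>\<^bsub>R\<^esub> c)) r x"
        using abc r by (simp add: mult_R_eq_conv mult_R_closed conv_assoc)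
    qed (use abc mult_R_closed in auto)
  next
    fix a assume a: "a \<in> carrier R"
    show "\<one>\<^bsub>R\<^esub> \<otimes>\<^bsub>R\<^esub> a = a"
    proof (rule R_eqI)
      fix r x assume r: "r \<in> carrier G"
      have "x \<in> topspace X" if "a r x \<noteq> 0"
        using R_coeff_nonzero[OF a that] Xt_subset by blast
      moreover have "(\<one>\<^bsub>R\<^esub> \<otimes>\<^bsub>R\<^esub> a) r x = unit_on \<one> x * a (inv \<one> \<otimes> r) (h (inv \<one>) x)"
        using r mult_R_eq_conv[OF one_R_closed a r] conv_single_left
        unfolding one_R by simp
      ultimately show "(\<one>\<^bsub>R\<^esub> \<otimes>\<^bsub>R\<^esub> a) r x = a r x"
        using r by (auto simp: Xt_one h_one)
    qed (use a one_R_closed mult_R_closed in auto)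
    show "a \<otimes>\<^bsub>R\<^esub> \<one>\<^bsub>R\<^esub> = a"
    proof (rule R_eqI)
      fix r x assume r: "r \<in> carrier G"
      have "h (inv r) x \<in> topspace X" if "a r x \<noteq> 0"
        using R_coeff_nonzero[OF a that] Xt_subset[of "inv r"] h_inv_maps r by blast
      moreover have "(a \<otimes>\<^bsub>R\<^esub> \<one>\<^bsub>R\<^esub>) r x = a r x * unit_on \<one> (h (inv r) x)"
        using r mult_R_eq_conv[OF a one_R_closed r] conv_single_right[OF a one_closed r]
        unfolding one_R by simp
      ultimately show "(a \<otimes>\<^bsub>R\<^esub> \<one>\<^bsub>R\<^esub>) r x = a r x"
        by (auto simp: Xt_one)
    qed (use a one_R_closed mult_R_closed in auto)
  qed (use one_R_closed mult_R_closed in auto)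
next
  fix a b c assume abc: "a \<in> carrier R" "b \<in> carrier R" "c \<in> carrier R"
  show "(a \<oplus>\<^bsub>R\<^esub> b) \<otimes>\<^bsub>R\<^esub> c = a \<otimes>\<^bsub>R\<^esub> c \<oplus>\<^bsub>R\<^esub> b \<otimes>\<^bsub>R\<^esub> c"
  proof (rule R_eqI)
    fix r x assume r: "r \<in> carrier G"
    show "((a \<oplus>\<^bsub>R\<^esub> b) \<otimes>\<^bsub>R\<^esub> c) r x = (a \<otimes>\<^bsub>R\<^esub> c \<oplus>\<^bsub>R\<^esub> b \<otimes>\<^bsub>R\<^esub> c) r x"
      using mult_R_eq_conv[OF add_R_closed[OF abc(1,2)] abc(3) r] abc r
      by (simp add: mult_R_eq_conv conv_add_left)
  qed (use abc mult_R_closed add_R_closed in blast)+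
  show "c \<otimes>\<^bsub>R\<^esub> (a \<oplus>\<^bsub>R\<^esub> b) = c \<otimes>\<^bsub>R\<^esub> a \<oplus>\<^bsub>R\<^esub> c \<otimes>\<^bsub>R\<^esub> b"
  proof (rule R_eqI)
    fix r x assume r: "r \<in> carrier G"
    show "(c \<otimes>\<^bsub>R\<^esub> (a \<oplus>\<^bsub>R\<^esub> b)) r x = (c \<otimes>\<^bsub>R\<^esub> a \<oplus>\<^bsub>R\<^esub> c \<otimes>\<^bsub>R\<^esub> b) r x"
      using mult_R_eq_conv[OF abc(3) add_R_closed[OF abc(1,2)] r] abc r
      by (simp add: mult_R_eq_conv conv_add_right)
  qed (use abc mult_R_closed add_R_closed in blast)+
qed

sublocale R: ring R
  by (rule ring_R)


section \<open>Ideals of the skew group ring\<close>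

lemma ideal_RI:
  assumes sub: "I \<subseteq> carrier R" and zero: "\<zero>\<^bsub>R\<^esub> \<in> I"
    and add: "\<And>a b. \<lbrakk>a \<in> I; b \<in> I\<rbrakk> \<Longrightarrow> a \<oplus>\<^bsub>R\<^esub> b \<in> I"
    and left: "\<And>a b. \<lbrakk>a \<in> I; b \<in> carrier R\<rbrakk> \<Longrightarrow> b \<otimes>\<^bsub>R\<^esub> a \<in> I"
    and right: "\<And>a b. \<lbrakk>a \<in> I; b \<in> carrier R\<rbrakk> \<Longrightarrow> a \<otimes>\<^bsub>R\<^esub> b \<in> I"
  shows "ideal I R"
proof (rule idealI[OF ring_R])
  have "\<ominus>\<^bsub>R\<^esub> a \<in> I" if a: "a \<in> I" for a
  proof -
    have "(\<ominus>\<^bsub>R\<^esub> \<one>\<^bsub>R\<^esub>) \<otimes>\<^bsub>R\<^esub> a \<in> I"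
      using left[OF a] R.a_inv_closed[OF R.one_closed] by blast
    moreover have "(\<ominus>\<^bsub>R\<^esub> \<one>\<^bsub>R\<^esub>) \<otimes>\<^bsub>R\<^esub> a = \<ominus>\<^bsub>R\<^esub> a"
      using R.l_minus[OF R.one_closed, of a] R.l_one[of a] a sub by (simp only: subsetD)
    ultimately show ?thesis by (simp only:)
  qed
  then show "subgroup I (add_monoid R)"
    using sub zero add by (intro subgroup.intro) (simp_all add: a_inv_def)
qed (use left right in auto)

text \<open>A summand of the product at \<open>x\<close> involves the second factor only at points
  \<open>h\<^bsub>inv t\<^esub> x\<close> of the orbit of \<open>x\<close>. If such a point lies in \<open>U\<close>, then so does \<open>x\<close>.\<close>

lemma ideal_vanishing_outside_invariant:
  assumes U: "invariant_set G Xt h U"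
  shows "ideal {a \<in> carrier R. \<forall>t x. x \<notin> U \<longrightarrow> a t x = 0} R" (is "ideal ?I R")
proof (rule ideal_RI)
  fix a b assume a: "a \<in> ?I" and b: "b \<in> carrier R"
  then have aR: "a \<in> carrier R" by simp
  have "(b \<otimes>\<^bsub>R\<^esub> a) r x = 0" if x: "x \<notin> U" for r x
  proof (rule ccontr)
    assume "(b \<otimes>\<^bsub>R\<^esub> a) r x \<noteq> 0"
    then have "conv b a r x \<noteq> 0"
      using mult_R_eq_conv[OF b aR] mult_R_outside by (cases "r \<in> carrier G") simp_all
    then obtain t where t: "b t x \<noteq> 0" "a (inv t \<otimes> r) (h (inv t) x) \<noteq> 0"
      using conv_nonzero by blast
    then have tx: "t \<in> carrier G" "x \<in> Xt t" using R_coeff_nonzero[OF b] by auto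
    have "h (inv t) x \<in> U" using t(2) a by blast
    then have "h t (h (inv t) x) \<in> U"
      using U tx h_inv_maps[OF tx] unfolding invariant_set_def by blast
    then show False using x h_h_inv[OF tx] by simp
  qed
  then show "b \<otimes>\<^bsub>R\<^esub> a \<in> ?I" using mult_R_closed[OF b aR] by simp
  have "(a \<otimes>\<^bsub>R\<^esub> b) r x = 0" if x: "x \<notin> U" for r x
  proof (cases "r \<in> carrier G")
    case True
    then show ?thesis using a x mult_R_eq_conv[OF aR b] by (simp add: conv_def)
  qed (simp add: mult_R_outside)
  then show "a \<otimes>\<^bsub>R\<^esub> b \<in> ?I" using mult_R_closed[OF aR b] by simp
next
  fix a b assume "a \<in> ?I" "b \<in> ?I"
  then show "a \<oplus>\<^bsub>R\<^esub> b \<in> ?I" using add_R_closed[of a b] by simp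
qed (use zero_R_closed in auto)

lemma conv_const: "conv a (\<lambda>_. \<phi>) r x = conv a (\<lambda>_. \<phi>) \<one> x"
  by (simp add: conv_def)

text \<open>The ring acts on the space of all functions \<open>\<phi>\<close> on \<open>X\<close> by
  \<open>(a \<cdot> \<phi>) x = \<Sum>t. a\<^sub>t (x) \<phi> (h\<^bsub>inv t\<^esub> x)\<close>, the convolution with a family that is constant
  in the group variable. The ideal below is the kernel of this representation.\<close>

lemma ideal_kernel_of_function_representation:
  "ideal {a \<in> carrier R. \<forall>\<phi> x. conv a (\<lambda>_. \<phi>) \<one> x = 0} R" (is "ideal ?I R")
proof (rule ideal_RI)
  fix a b assume a: "a \<in> ?I" and b: "b \<in> carrier R"
  then have aR: "a \<in> carrier R" by simp
  have "conv a (\<lambda>_. \<phi>) s y = 0" for \<phi> s y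
    using a conv_const[of a \<phi> s y] by simp
  then have "conv (b \<otimes>\<^bsub>R\<^esub> a) (\<lambda>_. \<phi>) \<one> x = 0" for \<phi> x
    using conv_assoc[OF b aR] by (simp add: conv_def[of b])
  then show "b \<otimes>\<^bsub>R\<^esub> a \<in> ?I" using mult_R_closed[OF b aR] by simp
  have "conv b (\<lambda>_. \<phi>) = (\<lambda>_. conv b (\<lambda>_. \<phi>) \<one>)" for \<phi>
    by (intro ext) (rule conv_const)
  then have "conv (a \<otimes>\<^bsub>R\<^esub> b) (\<lambda>_. \<phi>) \<one> x = conv a (\<lambda>_. conv b (\<lambda>_. \<phi>) \<one>) \<one> x" for \<phi> x
    using conv_assoc[OF aR b one_closed, of "\<lambda>_. \<phi>" x] by metis
  then show "a \<otimes>\<^bsub>R\<^esub> b \<in> ?I" using a mult_R_closed[OF aR b] by simp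
next
  fix a b assume "a \<in> ?I" "b \<in> ?I"
  then show "a \<oplus>\<^bsub>R\<^esub> b \<in> ?I" using add_R_closed[of a b] by (simp add: conv_add_left)
qed (use zero_R_closed in \<open>auto simp: conv_def\<close>)

section \<open>Simplicity implies minimality and topological freeness\<close>

lemma single_one_closed: "f \<in> carrier A \<Longrightarrow> single \<one> f \<in> carrier R"
  by (rule single_closed) (simp_all add: induced_ideal_one)

lemma simple_imp_minimal:
  assumes "simple_ring R"
  shows "minimal_action G X Xt h"
  unfolding minimal_action_def
proof (intro allI impI)
  fix U assume "openin X U \<and> invariant_set G Xt h U"
  then have U: "openin X U" "invariant_set G Xt h U" by auto
  let ?I = "{a \<in> carrier R. \<forall>t x. x \<notin> U \<longrightarrow> a t x = 0}"
  have "U = topspace X" if ne: "U \<noteq> {}"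
  proof -
    obtain x where x: "x \<in> U" using ne by blast
    obtain f where f: "f \<in> carrier A" "f x = 1" "\<And>y. y \<notin> U \<Longrightarrow> f y = 0"
      using exists_continuous_bump[OF compact Hausdorff U(1) x] by blast
    have "single \<one> f \<in> ?I"
      using single_one_closed[OF f(1)] f(3) by (simp add: single_def)
    moreover have "single \<one> f \<noteq> \<zero>\<^bsub>R\<^esub>"
      using f(2) by (auto simp: single_def fun_eq_iff intro!: exI[of _ x])
    ultimately have "?I = carrier R"
      using simple_ring.trivial_ideals[OF assms ideal_vanishing_outside_invariant[OF U(2)]]
      by blast
    then have "\<one>\<^bsub>R\<^esub> \<in> ?I" using one_R_closed by blast
    then have vanish: "single \<one> (unit_on \<one>) \<one> y = 0" if "y \<notin> U" for y
      using that unfolding one_R by blast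
    have "y \<in> U" if "y \<in> topspace X" for y
      using vanish[of y] that by (auto simp: single_def Xt_one)
    then show ?thesis using openin_subset[OF U(1)] by blast
  qed
  then show "U = {} \<or> U = topspace X" by blast
qed

text \<open>If \<open>h t\<close> fixes every point of a nonempty open set \<open>V\<close> and \<open>f\<close> is supported in \<open>V\<close>,
  then \<open>f \<delta>\<^sub>1\<close> and \<open>f \<delta>\<^sub>t\<close> act in the same way on functions on \<open>X\<close>. Their difference is a
  nonzero element of the kernel, which does not contain the unit.\<close>

lemma simple_imp_topologically_free:
  assumes "simple_ring R"
  shows "topologically_free G X Xt h"
  unfolding topologically_free_def
proof (intro ballI impI, rule ccontr)
  fix t assume t: "t \<in> carrier G" "t \<noteq> \<one>"
  define V where "V = X interior_of {x \<in> Xt (inv t). h t x = x}"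
  assume "X interior_of {x \<in> Xt (inv t). h t x = x} \<noteq> {}"
  then obtain x where x: "x \<in> V" by (auto simp: V_def)
  have V: "openin X V" "\<And>y. y \<in> V \<Longrightarrow> y \<in> Xt (inv t) \<and> h t y = y"
    using interior_of_subset[of X "{x \<in> Xt (inv t). h t x = x}"] by (auto simp: V_def)
  have fixed: "y \<in> Xt t" "h (inv t) y = y" if "y \<in> V" for y
    using V(2)[OF that] h_maps[of t y] h_inv_h[of t y] t by auto
  obtain f where f: "f \<in> carrier A" "f x = 1" "\<And>y. y \<notin> V \<Longrightarrow> f y = 0"
    using exists_continuous_bump[OF compact Hausdorff V(1) x] by blast
  let ?I = "{a \<in> carrier R. \<forall>\<phi> x. conv a (\<lambda>_. \<phi>) \<one> x = 0}"
  let ?b = "single \<one> f" and ?c = "single t (\<lambda>y. - f y)"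
  have "(\<lambda>y. - f y) \<in> D t"
    using f(1,3) fixed(1)
    by (auto simp: induced_ideal_def carrier_continuous_function_ring continuous_map_minus)
  then have bc: "?b \<in> carrier R" "?c \<in> carrier R"
    using single_closed[OF t(1)] single_one_closed[OF f(1)] by auto
  have "conv (?b \<oplus>\<^bsub>R\<^esub> ?c) (\<lambda>_. \<phi>) \<one> y = 0" for \<phi> y
  proof -
    have "conv (?b \<oplus>\<^bsub>R\<^esub> ?c) (\<lambda>_. \<phi>) \<one> y = f y * \<phi> (h \<one> y) - f y * \<phi> (h (inv t) y)"
      using conv_add_left[OF bc] t by (simp add: conv_single_left)
    also have "\<dots> = 0"
      using f(3)[of y] fixed(2)[of y] h_one[of y] openin_subset[OF V(1)] by (cases "y \<in> V") auto
    finally show ?thesis .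
  qed
  then have "?b \<oplus>\<^bsub>R\<^esub> ?c \<in> ?I" using add_R_closed[OF bc] by simp
  moreover have "(?b \<oplus>\<^bsub>R\<^esub> ?c) \<one> x = 1"
    using t(2) f(2) by (simp add: single_def)
  then have "?b \<oplus>\<^bsub>R\<^esub> ?c \<noteq> \<zero>\<^bsub>R\<^esub>"
    by (metis R_simps(2) zero_neq_one)
  ultimately have "?I = carrier R"
    using simple_ring.trivial_ideals[OF assms ideal_kernel_of_function_representation] by blast
  then have "conv \<one>\<^bsub>R\<^esub> (\<lambda>_ _. 1) \<one> x = 0" using one_R_closed by blast
  moreover have "x \<in> topspace X" using x openin_subset[OF V(1)] by blast
  ultimately show False
    unfolding one_R by (simp add: conv_single_left Xt_one)
qed

section \<open>Minimality and topological freeness imply simplicity\<close>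

lemma mult_single_right:
  assumes "a \<in> carrier R" "s \<in> carrier G" "f \<in> D s" "r \<in> carrier G"
  shows "(a \<otimes>\<^bsub>R\<^esub> single s f) r x = a (r \<otimes> inv s) x * f (h (inv (r \<otimes> inv s)) x)"
  using mult_R_eq_conv[OF assms(1) single_closed[OF assms(2,3)] assms(4)]
    conv_single_right[OF assms(1,2,4)] by simp

lemma mult_single_left:
  assumes "a \<in> carrier R" "s \<in> carrier G" "f \<in> D s" "r \<in> carrier G"
  shows "(single s f \<otimes>\<^bsub>R\<^esub> a) r x = f x * a (inv s \<otimes> r) (h (inv s) x)"
  using mult_R_eq_conv[OF single_closed[OF assms(2,3)] assms(1) assms(4)]
    conv_single_left[OF assms(2)] by simp

lemma openin_nonzero_set:
  assumes "f \<in> carrier A"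
  shows "openin X {x. f x \<noteq> 0}"
proof -
  have "openin X {x \<in> topspace X. f x \<in> - {0}}"
    using assms by (intro openin_continuous_map_preimage[of X euclidean])
      (auto simp: carrier_continuous_function_ring)
  moreover have "{x \<in> topspace X. f x \<in> - {0}} = {x. f x \<noteq> 0}"
    using assms by (auto simp: carrier_continuous_function_ring)
  ultimately show ?thesis by simp
qed

text \<open>Translating by the unit of the ideal at \<open>inv t\<close> moves the coefficient at \<open>t\<close> to the
  identity and does not enlarge the support.\<close>

lemma ideal_translate_to_one:
  assumes I: "ideal I R" and a: "a \<in> I" "a t x \<noteq> 0"
  obtains b where "b \<in> I" "b \<one> x \<noteq> 0" "card (supp b) \<le> card (supp a)"
proof -
  have aR: "a \<in> carrier R" using ideal.Icarr[OF I a(1)] .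
  then have tx: "t \<in> carrier G" "x \<in> Xt t" using a(2) R_coeff_nonzero by blast+
  let ?e = "single (inv t) (unit_on (inv t))"
  let ?b = "a \<otimes>\<^bsub>R\<^esub> ?e"
  have eR: "?e \<in> carrier R" using tx by (simp add: single_closed unit_on_closed)
  have b: "?b r y = a (r \<otimes> t) y * unit_on (inv t) (h (inv (r \<otimes> t)) y)"
    if "r \<in> carrier G" for r y
    using mult_single_right[OF aR _ unit_on_closed that, of "inv t" y] tx by simp
  have "supp ?b \<subseteq> (\<lambda>s. s \<otimes> inv t) ` supp a"
  proof
    fix r assume "r \<in> supp ?b"
    then have "r \<in> carrier G" "r \<otimes> t \<in> supp a"
      using b tx unfolding supp_iff by auto
    moreover have "r = (r \<otimes> t) \<otimes> inv t"
      using \<open>r \<in> carrier G\<close> tx by (simp add: m_assoc)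
    ultimately show "r \<in> (\<lambda>s. s \<otimes> inv t) ` supp a" by blast
  qed
  then have "card (supp ?b) \<le> card (supp a)"
    using finite_supp[OF aR] by (rule surj_card_le[rotated])
  moreover have "?b \<one> x \<noteq> 0"
    using b[of \<one> x] tx a(2) h_inv_maps[OF tx] by simp
  moreover have "?b \<in> I" using ideal.I_r_closed[OF I a(1) eR] .
  ultimately show ?thesis using that by blast
qed

text \<open>An element of minimal support whose coefficient at the identity is nonzero commutes with
  \<open>C(X)\<close>, because the commutators have smaller support. Since \<open>C(X)\<close> separates points,
  commuting means that a coefficient at \<open>r\<close> lives on the fixed points of \<open>h (inv r)\<close>.
  Topological freeness then leaves only the coefficient at the identity.\<close>

lemma nonzero_ideal_meets_functions:
  assumes free: "topologically_free G X Xt h" and I: "ideal I R" and nz: "I \<noteq> {\<zero>\<^bsub>R\<^esub>}"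
  obtains g x where "g \<in> carrier A" "g x \<noteq> 0" "single \<one> g \<in> I"
proof -
  have "\<zero>\<^bsub>R\<^esub> \<in> I"
    using additive_subgroup.zero_closed[OF ideal.axioms(1)[OF I]] .
  then obtain a0 where "a0 \<in> I \<and> a0 \<noteq> \<zero>\<^bsub>R\<^esub>" using nz by blast
  then obtain a where a: "a \<in> I" "a \<noteq> \<zero>\<^bsub>R\<^esub>"
      and least: "\<And>c. \<lbrakk>c \<in> I; c \<noteq> \<zero>\<^bsub>R\<^esub>\<rbrakk> \<Longrightarrow> card (supp a) \<le> card (supp c)"
    using ex_has_least_nat[of "\<lambda>c. c \<in> I \<and> c \<noteq> \<zero>\<^bsub>R\<^esub>" a0 "\<lambda>c. card (supp c)"] by blast
  then obtain t x where "a t x \<noteq> 0" by (auto simp: fun_eq_iff)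
  then obtain b where b: "b \<in> I" "b \<one> x \<noteq> 0" "card (supp b) \<le> card (supp a)"
    using ideal_translate_to_one[OF I a(1)] by blast
  have bR: "b \<in> carrier R" using ideal.Icarr[OF I b(1)] .
  have commute: "b r y * f (h (inv r) y) = b r y * f y"
    if f: "f \<in> carrier A" and r: "r \<in> carrier G" for f r y
  proof -
    let ?f' = "\<lambda>y. - f y"
    have f': "?f' \<in> carrier A"
      using f by (simp add: carrier_continuous_function_ring continuous_map_minus)
    let ?c = "single \<one> f \<otimes>\<^bsub>R\<^esub> b \<oplus>\<^bsub>R\<^esub> b \<otimes>\<^bsub>R\<^esub> single \<one> ?f'"
    have c: "?c s z = f z * b s z - b s z * f (h (inv s) z)" if s: "s \<in> carrier G" for s z
    proof -
      have "f z * b s (h \<one> z) = f z * b s z"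
        using h_one[of z] f by (cases "z \<in> topspace X")
          (auto simp: carrier_continuous_function_ring)
      then show ?thesis
        using mult_single_left[OF bR one_closed _ s, of f z]
          mult_single_right[OF bR one_closed _ s, of ?f' z] f f' s
        by (simp add: induced_ideal_one)
    qed
    have "?c \<in> I"
      using ideal.I_l_closed[OF I b(1) single_one_closed[OF f]]
        ideal.I_r_closed[OF I b(1) single_one_closed[OF f']]
        additive_subgroup.a_closed[OF ideal.axioms(1)[OF I]] by blast
    moreover have "supp ?c \<subset> supp b"
    proof
      show "supp ?c \<subseteq> supp b"
        using c unfolding supp_iff subset_iff by force
      have "?c \<one> z = 0" for z
        using c[OF one_closed, of z] h_one[of z] f
        by (cases "z \<in> topspace X") (use R_coeff_nonzero(2)[OF bR, of \<one> z] Xt_one in auto)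
      then have "\<one> \<notin> supp ?c" unfolding supp_iff by blast
      moreover have "\<one> \<in> supp b" using b(2) by (auto simp: supp_iff)
      ultimately show "supp ?c \<noteq> supp b" by blast
    qed
    then have "card (supp ?c) < card (supp a)"
      using less_le_trans[OF psubset_card_mono[OF finite_supp[OF bR]] b(3)] by blast
    ultimately have "?c = \<zero>\<^bsub>R\<^esub>" using least[of ?c] leD by blast
    then have "?c r y = 0" by (simp only: R_simps)
    then show ?thesis using c[OF r, of y] by (auto simp: mult.commute)
  qed
  have fixed: "h (inv r) y = y" if nz: "b r y \<noteq> 0" for r y
  proof (rule ccontr)
    assume ne: "h (inv r) y \<noteq> y"
    have ry: "r \<in> carrier G" "y \<in> Xt r" using R_coeff_nonzero[OF bR nz] by auto
    have "h (inv r) y \<in> topspace X" "y \<in> topspace X"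
      using h_inv_maps[OF ry] Xt_subset[of "inv r"] Xt_subset[of r] ry by auto
    then have "openin X (topspace X - {h (inv r) y})" "y \<in> topspace X - {h (inv r) y}"
      using closedin_Hausdorff_singleton[OF Hausdorff] ne by auto
    then obtain f where "f \<in> carrier A" "f y = 1" "f (h (inv r) y) = 0"
      using exists_continuous_bump[OF compact Hausdorff] by (metis DiffD2 singletonI)
    then show False using commute[of f r y] ry nz by simp
  qed
  have zero: "b r y = 0" if r: "r \<in> carrier G" "r \<noteq> \<one>" for r y
  proof (rule ccontr)
    assume nz: "b r y \<noteq> 0"
    have "{y. b r y \<noteq> 0} \<subseteq> {y \<in> Xt (inv (inv r)). h (inv r) y = y}"
      using fixed R_coeff_nonzero(2)[OF bR] r by auto
    then have "y \<in> X interior_of {y \<in> Xt (inv (inv r)). h (inv r) y = y}"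
      using nz openin_nonzero_set[OF R_coeff_closed[OF bR], of r]
      by (auto simp: interior_of_def)
    moreover have "inv r \<in> carrier G" "inv r \<noteq> \<one>"
      using r inv_eq_1_iff by auto
    ultimately show False using free unfolding topologically_free_def by blast
  qed
  have "b = single \<one> (b \<one>)"
    using zero by (intro R_eqI bR single_one_closed R_coeff_closed) (auto simp: single_def)
  then have "single \<one> (b \<one>) \<in> I" using b(1) by simp
  then show ?thesis using that[OF R_coeff_closed[OF bR] b(2)] by blast
qed

lemma single_one_mult:
  assumes "f \<in> carrier A" "g \<in> carrier A"
  shows "single \<one> f \<otimes>\<^bsub>R\<^esub> single \<one> g = single \<one> (\<lambda>x. f x * g x)"
proof (rule R_eqI)
  fix r x assume r: "r \<in> carrier G"
  have "f x * g (h \<one> x) = f x * g x"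
    using h_one[of x] assms by (cases "x \<in> topspace X")
      (auto simp: carrier_continuous_function_ring)
  then show "(single \<one> f \<otimes>\<^bsub>R\<^esub> single \<one> g) r x = single \<one> (\<lambda>x. f x * g x) r x"
    using mult_single_left[OF single_one_closed[OF assms(2)] one_closed _ r, of f x] assms r
    by (simp add: induced_ideal_one single_def)
qed (use assms single_one_closed continuous_function_ring_mult_closed mult_R_closed in blast)+

lemma single_one_add:
  "single \<one> f \<oplus>\<^bsub>R\<^esub> single \<one> g = single \<one> (\<lambda>x. f x + g x)"
  by (auto simp: single_def fun_eq_iff)

text \<open>By compactness finitely many of the functions have no common zero, and then the sum of
  their squared moduli is an invertible element of the ideal.\<close>

lemma ideal_without_common_zero_is_everything:
  assumes I: "ideal I R"
    and nz: "\<And>x. x \<in> topspace X \<Longrightarrow> \<exists>f. f \<in> carrier A \<and> single \<one> f \<in> I \<and> f x \<noteq> 0"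
  shows "I = carrier R"
proof -
  let ?J = "{f \<in> carrier A. single \<one> f \<in> I}"
  let ?N = "\<lambda>f :: 'a \<Rightarrow> complex. {x. f x \<noteq> 0}"
  have "\<forall>U \<in> ?N ` ?J. openin X U" using openin_nonzero_set by blast
  moreover have "topspace X \<subseteq> \<Union> (?N ` ?J)" using nz by blast
  ultimately obtain \<F> where "finite \<F>" "\<F> \<subseteq> ?N ` ?J" "topspace X \<subseteq> \<Union>\<F>"
    using compact unfolding compact_space_alt by meson
  moreover from this obtain F where "finite F" "F \<subseteq> ?J" "\<F> = ?N ` F"
    using finite_subset_image[of \<F> ?N ?J] by blast
  ultimately have F: "finite F" "F \<subseteq> ?J" "topspace X \<subseteq> \<Union> (?N ` F)"
    by simp_all
  define k where "k = (\<lambda>x. \<Sum>f\<in>F. cnj (f x) * f x)"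
  have sums: "(\<lambda>x. \<Sum>f\<in>F'. cnj (f x) * f x) \<in> ?J" if "finite F'" "F' \<subseteq> ?J" for F'
    using that
  proof (induction F')
    case empty
    have "single \<one> (\<lambda>x. 0) = \<zero>\<^bsub>R\<^esub>" by (auto simp: single_def fun_eq_iff)
    then show ?case
      using additive_subgroup.zero_closed[OF ideal.axioms(1)[OF I]]
      by (simp add: continuous_function_ring_zero_closed)
  next
    case (insert f F')
    then have f: "f \<in> carrier A" "single \<one> f \<in> I" by auto
    have cf: "(\<lambda>x. cnj (f x)) \<in> carrier A"
      using f by (auto simp: carrier_continuous_function_ring continuous_map_atin
          intro: tendsto_cnj)
    have "single \<one> (\<lambda>x. cnj (f x) * f x) \<in> I"
      using ideal.I_l_closed[OF I f(2) single_one_closed[OF cf]] single_one_mult[OF cf f(1)]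
      by simp
    moreover have "single \<one> (\<lambda>x. \<Sum>f\<in>F'. cnj (f x) * f x) \<in> I"
      using insert by blast
    ultimately have "single \<one> (\<lambda>x. cnj (f x) * f x + (\<Sum>f\<in>F'. cnj (f x) * f x)) \<in> I"
      unfolding single_one_add[symmetric]
      by (rule additive_subgroup.a_closed[OF ideal.axioms(1)[OF I]])
    moreover have "(\<lambda>x. cnj (f x) * f x + (\<Sum>f\<in>F'. cnj (f x) * f x)) \<in> carrier A"
      using insert by (intro continuous_function_ring_add_closed
          continuous_function_ring_mult_closed cf f) auto
    ultimately show ?case using insert by simp
  qed
  have k: "k \<in> carrier A" "single \<one> k \<in> I"
    using sums[OF F(1,2)] by (auto simp: k_def)
  have knz: "k x \<noteq> 0" if x: "x \<in> topspace X" for x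
  proof -
    have "k x = complex_of_real (\<Sum>f\<in>F. (norm (f x))\<^sup>2)"
      unfolding k_def of_real_sum
      by (intro sum.cong refl) (metis complex_norm_square mult.commute)
    moreover have "(\<Sum>f\<in>F. (norm (f x))\<^sup>2) > 0"
    proof -
      obtain f where "f \<in> F" "f x \<noteq> 0" using F(3) x by blast
      then show ?thesis using F(1) by (intro sum_pos2[of F f]) auto
    qed
    ultimately show ?thesis by (metis less_irrefl of_real_eq_0_iff)
  qed
  (* Outside the space k is 0, and the convention inverse 0 = 0 keeps the extension by zero. *)
  have ik: "(\<lambda>x. inverse (k x)) \<in> carrier A"
    using k(1) knz
    by (auto simp: carrier_continuous_function_ring continuous_map_atin intro: tendsto_inverse)
  have "(\<lambda>x. inverse (k x) * k x) = unit_on \<one>"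
    using knz k(1) by (auto simp: Xt_one carrier_continuous_function_ring)
  then have "\<one>\<^bsub>R\<^esub> \<in> I"
    using ideal.I_l_closed[OF I k(2) single_one_closed[OF ik]] single_one_mult[OF ik k(1)]
    unfolding one_R by simp
  then show ?thesis by (rule ideal.one_imp_carrier[OF I])
qed

text \<open>The set where some function of the ideal does not vanish is open, and it is invariant
  since conjugation by \<open>\<delta>\<^sub>t\<close> carries a function \<open>f\<close> in the ideal to \<open>f \<circ> h\<^bsub>inv t\<^esub>\<close>,
  extended by zero from \<open>Xt t\<close>.\<close>

lemma free_and_minimal_imp_simple:
  assumes free: "topologically_free G X Xt h" and minimal: "minimal_action G X Xt h"
  shows "simple_ring R"
proof (rule simple_ring.intro[OF ring_R], rule simple_ring_axioms.intro)
  fix I assume I: "ideal I R"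
  define U where "U = {x. \<exists>f. f \<in> carrier A \<and> single \<one> f \<in> I \<and> f x \<noteq> 0}"
  have "U = (\<Union>f \<in> {f \<in> carrier A. single \<one> f \<in> I}. {x. f x \<noteq> 0})"
    by (auto simp: U_def)
  then have openU: "openin X U" using openin_nonzero_set by auto
  have "h t x \<in> U" if t: "t \<in> carrier G" and x: "x \<in> U" "x \<in> Xt (inv t)" for t x
  proof -
    obtain f where f: "f \<in> carrier A" "single \<one> f \<in> I" "f x \<noteq> 0"
      using x(1) by (auto simp: U_def)
    let ?u = "single t (unit_on t)" and ?v = "single (inv t) (unit_on (inv t))"
    have uv: "?u \<in> carrier R" "?v \<in> carrier R"
      using t by (auto intro!: single_closed unit_on_closed)
    have fR: "single \<one> f \<in> carrier R" using single_one_closed[OF f(1)] .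
    have ufR: "?u \<otimes>\<^bsub>R\<^esub> single \<one> f \<in> carrier R" using mult_R_closed[OF uv(1) fR] .
    have ufv: "(?u \<otimes>\<^bsub>R\<^esub> single \<one> f \<otimes>\<^bsub>R\<^esub> ?v) r y =
        unit_on t y * single \<one> f (inv t \<otimes> (r \<otimes> t)) (h (inv t) y) *
        unit_on (inv t) (h (inv (r \<otimes> t)) y)" if r: "r \<in> carrier G" for r y
      using mult_single_right[OF ufR _ unit_on_closed r, of "inv t" y]
        mult_single_left[OF fR t unit_on_closed[OF t], of "r \<otimes> t" y] t r
      by simp
    have conj_eq_one: "inv t \<otimes> (r \<otimes> t) = \<one> \<longleftrightarrow> r = \<one>" if "r \<in> carrier G" for r
      using that t inv_solve_left[of \<one> t "r \<otimes> t"] inv_solve_right[of r t t] by auto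
    have I': "?u \<otimes>\<^bsub>R\<^esub> single \<one> f \<otimes>\<^bsub>R\<^esub> ?v \<in> I"
      using ideal.I_r_closed[OF I ideal.I_l_closed[OF I f(2) uv(1)] uv(2)] .
    let ?g = "(?u \<otimes>\<^bsub>R\<^esub> single \<one> f \<otimes>\<^bsub>R\<^esub> ?v) \<one>"
    have g: "?g \<in> carrier A" using R_coeff_closed[OF ideal.Icarr[OF I I']] .
    have "?u \<otimes>\<^bsub>R\<^esub> single \<one> f \<otimes>\<^bsub>R\<^esub> ?v = single \<one> ?g"
    proof (rule R_eqI)
      fix r y assume r: "r \<in> carrier G"
      show "(?u \<otimes>\<^bsub>R\<^esub> single \<one> f \<otimes>\<^bsub>R\<^esub> ?v) r y = single \<one> ?g r y"
        using ufv[OF r] conj_eq_one[OF r] by (cases "r = \<one>") (simp_all add: single_def)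
    qed (use ideal.Icarr[OF I I'] single_one_closed[OF g] in auto)
    moreover have "?g (h t x) \<noteq> 0"
      using ufv[OF one_closed, of "h t x"] h_maps[OF t x(2)] h_inv_h[OF t x(2)] t x(2) f(3)
      by (simp add: single_def)
    ultimately show ?thesis using g I' unfolding U_def by (intro CollectI exI[of _ ?g]) simp
  qed
  then have "invariant_set G Xt h U" unfolding invariant_set_def by blast
  then consider "U = {}" | "U = topspace X"
    using minimal openU unfolding minimal_action_def by blast
  then show "I = {\<zero>\<^bsub>R\<^esub>} \<or> I = carrier R"
  proof cases
    case 1
    then show ?thesis
      using nonzero_ideal_meets_functions[OF free I] unfolding U_def by blast
  next
    case 2
    then have "I = carrier R"
      by (intro ideal_without_common_zero_is_everything[OF I]) (auto simp: U_def)
    then show ?thesis ..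
  qed
qed

end

theorem theorem4p1:
  fixes G :: "('g, 'm) monoid_scheme" and X :: "'a topology"
    and Xt :: "'g \<Rightarrow> 'a set" and h :: "'g \<Rightarrow> 'a \<Rightarrow> 'a"
  assumes "topological_partial_action G X Xt h"
    and "compact_space X" and "Hausdorff_space X"
    and "\<And>t. t \<in> carrier G \<Longrightarrow> closedin X (Xt t) \<and> openin X (Xt t)"
  shows "simple_ring (partial_skew_group_ring G (continuous_function_ring X)
            (induced_ideal X Xt) (induced_map G Xt h))
      \<longleftrightarrow> topologically_free G X Xt h \<and> minimal_action G X Xt h"
proof -
  interpret topological_partial_action G X Xt h by fact
  interpret clopen_partial_action G X Xt h
    by unfold_locales (use assms(2-4) in auto)
  show ?thesis
    using simple_imp_topologically_free simple_imp_minimal free_and_minimal_imp_simple by blast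
qed

end
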